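(* Let $0\le k<d$ be integers and let $\mathcal{F}_1,\mathcal{F}_2,\ldots$ be an infinite sequence of families of closed balls in $\mathbb{R}^d$. If every infinite heterochromatic sequence of balls contains $k+2$ balls with a $k$-transversal, then there exists an $\mathcal{F}_i$ which can be pierced by finitely many $k$-flats.
   Context: For a sequence $\mathcal{F}_1,\mathcal{F}_2,\ldots$ of families, an infinite sequence of elements $C_1,C_2,\ldots$ is heterochromatic if there exist indices $i_1<i_2<\ldots$ with $C_j\in\mathcal{F}_{i_j}$ for all $j$. A $k$-flat is a $k$-dimensional affine subspace of $\mathbb{R}^d$. Balls (terms of the sequence with distinct indices) have a $k$-transversal if there is a single $k$-flat intersecting all of them. A family can be pierced by finitely many $k$-flats if there is a finite set of $k$-flats such that each member of the family is intersected by at least one of them. Balls are Euclidean and have arbitrary radii. *)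

theory Defs
  imports "HOL-Analysis.Analysis"
begin

(* Degenerate balls (single points, radius 0) are admitted; the empty set is not a ball. *)
definition closed_ball :: "'a::metric_space set \<Rightarrow> bool" where
  "closed_ball B \<longleftrightarrow> (\<exists>c r. 0 \<le> r \<and> B = cball c r)"

definition flat :: "nat \<Rightarrow> 'a::euclidean_space set \<Rightarrow> bool" where
  "flat k V \<longleftrightarrow> affine V \<and> aff_dim V = int k"

definition has_transversal :: "nat \<Rightarrow> 'a::euclidean_space set set \<Rightarrow> bool" where
  "has_transversal k \<B> \<longleftrightarrow> (\<exists>V. flat k V \<and> (\<forall>B\<in>\<B>. V \<inter> B \<noteq> {}))"

definition finitely_pierceable :: "nat \<Rightarrow> 'a::euclidean_space set set \<Rightarrow> bool" where
  "finitely_pierceable k \<F> \<longleftrightarrow>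
     (\<exists>P. finite P \<and> (\<forall>V\<in>P. flat k V) \<and> (\<forall>B\<in>\<F>. \<exists>V\<in>P. V \<inter> B \<noteq> {}))"

definition heterochromatic :: "(nat \<Rightarrow> 'b set) \<Rightarrow> (nat \<Rightarrow> 'b) \<Rightarrow> bool" where
  "heterochromatic \<F> C \<longleftrightarrow> (\<exists>i :: nat \<Rightarrow> nat. strict_mono i \<and> (\<forall>j. C j \<in> \<F> (i j)))"

(* The terms are counted by index, not as sets: a ball occurring n times in the
   sequence contributes n terms. *)
definition has_terms_with_transversal ::
    "nat \<Rightarrow> nat \<Rightarrow> (nat \<Rightarrow> 'a::euclidean_space set) \<Rightarrow> bool" where
  "has_terms_with_transversal m k C \<longleftrightarrow>
     (\<exists>J. finite J \<and> card J = m \<and> has_transversal k (C ` J))"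

end

theory Submission
  imports Defs
begin

text \<open>Suppose that no family can be pierced. The sets of balls whose complement is finitely pierceable in
  all late families form a filter; extend it to an ultrafilter \<open>V\<close>. Every \<open>k\<close>-flat misses \<open>V\<close>-almost all
  balls, and every \<open>V\<close>-large set meets arbitrarily late families. It suffices to show that for almost all
  \<open>B\<^sub>1\<close>, for almost all \<open>B\<^sub>2\<close>, and so on for \<open>k + 2\<close> balls, no \<open>k\<close>-flat meets all of them: the
  heterochromatic sequence is then chosen ball by ball.

  Otherwise take the limit of the common transversal along \<open>V\<close>, first in the last ball, then in the last but
  one, and so on. Each limit forces the transversal to contain one more fixed direction, namely the limiting
  direction of the balls as seen from the subspace fixed so far: either the balls look small from there, so
  that they determine this direction, or they look large and are hit by one fixed flat. After \<open>k + 1\<close> limits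
  the transversal is a fixed flat that meets almost all balls, a contradiction.\<close>

section \<open>Ultrafilters and limits along them\<close>

definition ultrafilter :: "'b filter \<Rightarrow> bool" where
  "ultrafilter V \<longleftrightarrow> V \<noteq> bot \<and> (\<forall>P. eventually P V \<or> eventually (\<lambda>x. \<not> P x) V)"

lemma ultrafilter_nontrivial: "ultrafilter V \<Longrightarrow> V \<noteq> bot"
  by (simp add: ultrafilter_def)

lemma ultrafilter_not_eventually:
  "ultrafilter V \<Longrightarrow> \<not> eventually P V \<Longrightarrow> eventually (\<lambda>x. \<not> P x) V"
  by (auto simp: ultrafilter_def)

text \<open>Zorn's lemma on the proper filters below \<open>F\<close>: the infimum of a chain is
  proper, and a minimal proper filter decides every \<open>P\<close>, because restricting it to
  \<open>P\<close> gives either itself or \<open>bot\<close>.\<close>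

lemma ultrafilter_exists:
  assumes "F \<noteq> bot"
  obtains V where "ultrafilter V" "V \<le> F"
proof -
  define A where "A = {G. G \<noteq> bot \<and> G \<le> F}"
  have "\<exists>m\<in>A. \<forall>a\<in>A. a \<le> m \<longrightarrow> a = m"
  proof (rule predicate_Zorn)
    show "partial_order_on A (relation_of (\<lambda>x y. y \<le> x) A)"
      by (rule partial_order_on_relation_ofI) auto
  next
    fix C assume C: "C \<in> Chains (relation_of (\<lambda>x y. y \<le> x) A)"
    have CA: "C \<subseteq> A" and chain: "\<And>x y. x \<in> C \<Longrightarrow> y \<in> C \<Longrightarrow> x \<le> y \<or> y \<le> x"
      using C unfolding Chains_def relation_of_def by auto
    show "\<exists>u\<in>A. \<forall>a\<in>C. u \<le> a"
    proof (cases "C = {}")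
      case True
      then show ?thesis using assms by (auto simp: A_def)
    next
      case False
      have "eventually P (Inf C) \<longleftrightarrow> (\<exists>b\<in>C. eventually P b)" for P
        by (rule eventually_Inf_base[OF False]) (metis chain inf.absorb1 inf.absorb2 order_refl)
      then have "Inf C \<noteq> bot"
        using CA by (auto simp: trivial_limit_def A_def)
      moreover have "Inf C \<le> F"
        using False CA by (auto simp: A_def intro: Inf_lower2)
      ultimately show ?thesis
        by (auto simp: A_def intro!: bexI[of _ "Inf C"] Inf_lower)
    qed
  qed
  then obtain V where V: "V \<noteq> bot" "V \<le> F"
    and max: "\<And>G. G \<noteq> bot \<Longrightarrow> G \<le> V \<Longrightarrow> G = V"
    unfolding A_def by (metis (mono_tags, lifting) mem_Collect_eq order_trans)
  have "eventually P V \<or> eventually (\<lambda>x. \<not> P x) V" for P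
  proof (cases "inf V (principal {x. P x}) = bot")
    case True
    then have "eventually (\<lambda>x. False) (inf V (principal {x. P x}))"
      by simp
    then show ?thesis
      by (simp add: eventually_inf_principal)
  next
    case False
    then have "inf V (principal {x. P x}) = V"
      by (intro max) auto
    then have "V \<le> principal {x. P x}"
      by (metis inf_le2)
    then show ?thesis
      by (simp add: le_principal)
  qed
  then show thesis
    using that V by (auto simp: ultrafilter_def)
qed

text \<open>A cluster point along an ultrafilter is a limit: if a neighbourhood of it were not
  large, the complement would be, and the point could not be a cluster point.\<close>

lemma ultrafilter_compact_tendsto:
  fixes f :: "'b \<Rightarrow> 'c::topological_space"
  assumes V: "ultrafilter V" and K: "compact K" and f: "eventually (\<lambda>x. f x \<in> K) V"
  obtains l where "l \<in> K" "(f \<longlongrightarrow> l) V"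
proof -
  have "filtermap f V \<noteq> bot"
    using V by (simp add: ultrafilter_nontrivial filtermap_bot_iff)
  moreover have "eventually (\<lambda>x. x \<in> K) (filtermap f V)"
    using f by (simp add: eventually_filtermap)
  ultimately obtain l where l: "l \<in> K" "inf (nhds l) (filtermap f V) \<noteq> bot"
    using K unfolding compact_filter by blast
  have "(f \<longlongrightarrow> l) V"
  proof (rule topological_tendstoI, rule ccontr)
    fix S assume S: "open S" "l \<in> S" "\<not> eventually (\<lambda>x. f x \<in> S) V"
    then have "eventually (\<lambda>x. x \<notin> S) (filtermap f V)"
      using ultrafilter_not_eventually[OF V] by (simp add: eventually_filtermap)
    moreover have "eventually (\<lambda>x. x \<in> S) (nhds l)"
      using S by (simp add: eventually_nhds) blast
    ultimately have "eventually (\<lambda>x. False) (inf (nhds l) (filtermap f V))"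
      by (auto simp: eventually_inf)
    then show False using l by (simp add: trivial_limit_def)
  qed
  then show thesis using that l by blast
qed

lemma ultrafilter_bounded_tendsto:
  fixes f :: "'b \<Rightarrow> 'c::euclidean_space"
  assumes "ultrafilter V" "eventually (\<lambda>x. norm (f x) \<le> R) V"
  obtains l where "(f \<longlongrightarrow> l) V"
  using ultrafilter_compact_tendsto[OF assms(1), of "cball 0 R" f] assms(2) by auto

section \<open>Limits of subspaces and orthogonal projections\<close>

text \<open>An orthonormal basis padded with zeros to length \<open>n\<close>: subspaces of
  different dimensions get bounded frames over one index set.\<close>

lemma subspace_coordinate_frame:
  fixes W :: "'e::euclidean_space set"
  assumes W: "subspace W" "dim W \<le> n"
  obtains e :: "nat \<Rightarrow> 'e" where "\<And>i. norm (e i) \<le> 1"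
    "\<And>v. v \<in> W \<Longrightarrow> v = (\<Sum>i<n. (v \<bullet> e i) *\<^sub>R e i)"
proof -
  obtain B where B: "B \<subseteq> W" "pairwise orthogonal B" "\<And>x. x \<in> B \<Longrightarrow> norm x = 1"
    "independent B" "card B = dim W" "span B = W"
    using orthonormal_basis_subspace[OF W(1)] by metis
  have finB: "finite B" using B(4) by (rule finiteI_independent)
  obtain h where h: "bij_betw h {..<card B} B"
    using ex_bij_betw_nat_finite[OF finB] atLeast0LessThan by auto
  define e where "e i = (if i < card B then h i else 0)" for i
  have "norm (e i) \<le> 1" for i
    using bij_betwE[OF h] B(3) by (auto simp: e_def intro: order_eq_refl)
  moreover have "v = (\<Sum>i<n. (v \<bullet> e i) *\<^sub>R e i)" if "v \<in> W" for v
  proof -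
    obtain c where c: "v = (\<Sum>b\<in>B. c b *\<^sub>R b)"
      using \<open>v \<in> W\<close> finB B(6) by (auto simp: span_finite)
    have "v \<bullet> b = c b" if "b \<in> B" for b
    proof -
      have "v \<bullet> b = (\<Sum>a\<in>B. c a * (a \<bullet> b))"
        by (simp add: c inner_sum_left)
      also have "\<dots> = (\<Sum>a\<in>B. if a = b then c b else 0)"
      proof (rule sum.cong)
        fix a assume "a \<in> B"
        show "c a * (a \<bullet> b) = (if a = b then c b else 0)"
        proof (cases "a = b")
          case True
          then show ?thesis using B(3)[OF that] by (simp add: dot_square_norm)
        next
          case False
          then show ?thesis
            using B(2) \<open>a \<in> B\<close> that by (auto simp: pairwise_def orthogonal_def)
        qed
      qed simp
      also have "\<dots> = c b" using finB that by simp
      finally show ?thesis .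
    qed
    then have "v = (\<Sum>b\<in>B. (v \<bullet> b) *\<^sub>R b)"
      using c by simp
    also have "\<dots> = (\<Sum>i<card B. (v \<bullet> h i) *\<^sub>R h i)"
      by (rule sum.reindex_bij_betw[OF h, symmetric])
    also have "\<dots> = (\<Sum>i<card B. (v \<bullet> e i) *\<^sub>R e i)"
      by (simp add: e_def)
    also have "\<dots> = (\<Sum>i<n. (v \<bullet> e i) *\<^sub>R e i)"
      using W(2) B(5) by (intro sum.mono_neutral_left) (auto simp: e_def)
    finally show ?thesis .
  qed
  ultimately show thesis using that by blast
qed

text \<open>Compactness of the Grassmannian in elementary form: the frames converge along the
  ultrafilter, and the expansion of \<open>f x\<close> in its frame passes to the limit, so limits
  lie in the span of the limit frame.\<close>

lemma ultrafilter_limit_subspace: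
  fixes W :: "'b \<Rightarrow> 'e::euclidean_space set"
  assumes V: "ultrafilter V" and W: "\<And>x. subspace (W x)" "\<And>x. dim (W x) \<le> n"
  obtains U where "subspace U" "dim U \<le> n"
    "\<And>f v. eventually (\<lambda>x. f x \<in> W x) V \<Longrightarrow> (f \<longlongrightarrow> v) V \<Longrightarrow> v \<in> U"
proof -
  have "\<exists>e::nat \<Rightarrow> 'e. (\<forall>i. norm (e i) \<le> 1) \<and> (\<forall>v\<in>W x. v = (\<Sum>i<n. (v \<bullet> e i) *\<^sub>R e i))" for x
    by (rule subspace_coordinate_frame[OF W]) blast
  then obtain e :: "'b \<Rightarrow> nat \<Rightarrow> 'e" where e: "\<And>x i. norm (e x i) \<le> 1"
    "\<And>x v. v \<in> W x \<Longrightarrow> v = (\<Sum>i<n. (v \<bullet> e x i) *\<^sub>R e x i)"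
    by metis
  have "\<exists>l. ((\<lambda>x. e x i) \<longlongrightarrow> l) V" for i
    by (rule ultrafilter_bounded_tendsto[OF V, of "\<lambda>x. e x i" 1]) (use e(1) in auto)
  then obtain l where l: "\<And>i. ((\<lambda>x. e x i) \<longlongrightarrow> l i) V"
    by metis
  show thesis
  proof (rule that[of "span (l ` {..<n})"])
    show "dim (span (l ` {..<n})) \<le> n"
      using dim_le_card[of "l ` {..<n}" "l ` {..<n}"] card_image_le[of "{..<n}" l]
      by (simp add: span_superset)
  next
    fix f v assume f: "eventually (\<lambda>x. f x \<in> W x) V" "(f \<longlongrightarrow> v) V"
    have "((\<lambda>x. \<Sum>i<n. (f x \<bullet> e x i) *\<^sub>R e x i) \<longlongrightarrow> (\<Sum>i<n. (v \<bullet> l i) *\<^sub>R l i)) V"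
      by (intro tendsto_intros f l)
    moreover have "eventually (\<lambda>x. (\<Sum>i<n. (f x \<bullet> e x i) *\<^sub>R e x i) = f x) V"
      using f(1) by eventually_elim (use e(2) in metis)
    ultimately have "(f \<longlongrightarrow> (\<Sum>i<n. (v \<bullet> l i) *\<^sub>R l i)) V"
      by (rule Lim_transform_eventually)
    then have "v = (\<Sum>i<n. (v \<bullet> l i) *\<^sub>R l i)"
      using f(2) tendsto_unique ultrafilter_nontrivial[OF V] by blast
    then show "v \<in> span (l ` {..<n})"
      by (metis (no_types, lifting) imageI span_base span_scale span_sum)
  qed (rule subspace_span)
qed

lemma orthogonal_complement_projection:
  fixes M :: "'e::euclidean_space set"
  assumes M: "subspace M"
  obtains \<pi> where "linear \<pi>" "\<And>v. v - \<pi> v \<in> M" "\<And>v. norm (\<pi> v) \<le> norm v"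
    "\<And>v u. u \<in> M \<Longrightarrow> \<pi> v \<bullet> u = 0" "\<And>v. v \<in> M \<Longrightarrow> \<pi> v = 0"
proof -
  have "\<exists>z. v - z \<in> M \<and> (\<forall>u\<in>M. z \<bullet> u = 0)" for v
  proof -
    obtain y z where "y \<in> span M" "\<And>u. u \<in> span M \<Longrightarrow> orthogonal z u" "v = y + z"
      using orthogonal_subspace_decomp_exists[of M v] by blast
    then show ?thesis
      using M by (intro exI[of _ z]) (auto simp: span_eq_iff[THEN iffD2] orthogonal_def)
  qed
  then obtain \<pi> where \<pi>: "\<And>v. v - \<pi> v \<in> M" "\<And>v u. u \<in> M \<Longrightarrow> \<pi> v \<bullet> u = 0"
    by metis
  have uniq: "z = \<pi> v" if "v - z \<in> M" "\<And>u. u \<in> M \<Longrightarrow> z \<bullet> u = 0" for v z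
  proof -
    have "z - \<pi> v \<in> M"
      using subspace_diff[OF M \<pi>(1)[of v] that(1)] by simp
    then have "(z - \<pi> v) \<bullet> (z - \<pi> v) = 0"
      using \<pi>(2) that(2) by (simp add: inner_diff_left)
    then show ?thesis by simp
  qed
  have "linear \<pi>"
  proof (rule linearI)
    fix v w show "\<pi> (v + w) = \<pi> v + \<pi> w"
      using subspace_add[OF M \<pi>(1)[of v] \<pi>(1)[of w]] \<pi>(2)
      by (intro uniq[symmetric]) (auto simp: inner_add_left algebra_simps)
  next
    fix c v show "\<pi> (c *\<^sub>R v) = c *\<^sub>R \<pi> v"
      using subspace_scale[OF M \<pi>(1)[of v], of c] \<pi>(2)
      by (intro uniq[symmetric]) (auto simp: algebra_simps)
  qed
  moreover have "norm (\<pi> v) \<le> norm v" for v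
  proof -
    have "\<pi> v \<bullet> \<pi> v = \<pi> v \<bullet> v"
      using \<pi>(2)[OF \<pi>(1), of v v] by (simp add: inner_diff_right)
    then have "norm (\<pi> v) * norm (\<pi> v) \<le> norm (\<pi> v) * norm v"
      by (metis norm_cauchy_schwarz power2_eq_square power2_norm_eq_inner)
    then show ?thesis by (cases "\<pi> v = 0") auto
  qed
  moreover have "\<pi> v = 0" if "v \<in> M" for v
    using that by (intro uniq[symmetric]) auto
  ultimately show thesis using that \<pi> by blast
qed

section \<open>Flats as slices of linear subspaces\<close>

lemma flat_superset_exists:
  fixes A :: "'a::euclidean_space set"
  assumes "aff_dim A \<le> int k" "k \<le> DIM('a)"
  obtains V where "flat k V" "A \<subseteq> V"
proof -
  have "\<exists>V. flat k V \<and> A \<subseteq> V" if "aff_dim A + int n = int k" for n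
    using that
  proof (induction n arbitrary: A)
    case 0
    then show ?case
      by (intro exI[of _ "affine hull A"]) (auto simp: flat_def hull_subset)
  next
    case (Suc n)
    then have "affine hull A \<noteq> UNIV"
      using assms(2) by (metis aff_dim_affine_hull aff_dim_UNIV add_le_same_cancel1 nat_le_iff
          not_less_eq_eq of_nat_le_iff of_nat_le_0_iff le_zero_eq nat.distinct(1))
    then obtain x where "x \<notin> affine hull A" by auto
    then have "aff_dim (insert x A) + int n = int k"
      using Suc.prems by (simp add: aff_dim_insert)
    from Suc.IH[OF this] show ?case by auto
  qed
  from this[of "nat (int k - aff_dim A)"] show thesis
    using assms(1) that by auto
qed

text \<open>Differences of points at height 1 have height 0, so a point \<open>(a, 1)\<close> of
  \<open>U\<close> is independent of them and uses up one dimension of \<open>U\<close>.\<close>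

lemma flat_of_subspace:
  fixes U :: "('a::euclidean_space \<times> real) set"
  assumes U: "subspace U" "dim U \<le> k + 1" and k: "k \<le> DIM('a)"
  obtains V where "flat k V" "{p. (p, 1) \<in> U} \<subseteq> V"
proof -
  define A where "A = {p. (p, 1) \<in> U}"
  have "aff_dim A \<le> int k"
  proof (cases "A = {}")
    case False
    then obtain a where a: "(a, 1) \<in> U" by (auto simp: A_def)
    define D where "D = (+) (- a) ` A"
    define i where "i = (\<lambda>v::'a. (v, 0::real))"
    have lin: "linear i" by (auto simp: i_def intro: linearI)
    have inj: "inj i" by (auto simp: i_def inj_def)
    have iD: "i ` D \<subseteq> U"
    proof
      fix y assume "y \<in> i ` D"
      then obtain p where "(p, 1) \<in> U" "y = (p, 1) - (a, 1)"
        by (auto simp: D_def A_def i_def)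
      then show "y \<in> U" using subspace_diff[OF U(1)] a by blast
    qed
    have "span (i ` D) \<subseteq> {y. snd y = 0}"
      by (rule span_minimal) (auto simp: i_def subspace_def)
    then have "(a, 1) \<notin> span (i ` D)" by auto
    then have "dim (insert (a, 1) (i ` D)) = dim D + 1"
      using dim_image_eq[OF lin] inj by (simp add: dim_insert inj_on_subset[OF inj])
    moreover have "dim (insert (a, 1) (i ` D)) \<le> dim U"
      using iD a by (intro dim_subset) auto
    ultimately have "dim D \<le> k" using U(2) by simp
    moreover have "aff_dim A = int (dim D)"
      unfolding D_def using a by (intro aff_dim_eq_dim hull_inc) (simp add: A_def)
    ultimately show ?thesis by simp
  qed simp
  then show thesis
    using flat_superset_exists[OF _ k] that by (auto simp: A_def)
qed

lemma subspace_of_flat: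
  fixes V :: "'a::euclidean_space set"
  assumes "flat k V"
  obtains U :: "('a \<times> real) set" where "subspace U" "dim U \<le> k + 1" "\<And>p. p \<in> V \<Longrightarrow> (p, 1) \<in> U"
proof -
  have V: "aff_dim V = int k" using assms by (simp add: flat_def)
  then obtain a where a: "a \<in> V"
    by (metis aff_dim_empty ex_in_conv int_one_le_iff_zero_less neg_0_le_iff_le not_one_le_zero
        of_nat_0_le_iff)
  define D where "D = (+) (- a) ` V"
  define i where "i = (\<lambda>v::'a. (v, 0::real))"
  have lin: "linear i" by (auto simp: i_def intro: linearI)
  have "dim D = k"
    using aff_dim_eq_dim[OF hull_inc[OF a]] V by (simp add: D_def)
  then have "dim (insert (a, 1) (i ` D)) \<le> k + 1"
    using dim_image_le[OF lin, of D] by (simp add: dim_insert)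
  moreover have "(p, 1) \<in> span (insert (a, 1) (i ` D))" if "p \<in> V" for p
  proof -
    have "i (- a + p) \<in> span (insert (a, 1) (i ` D))"
      using that by (intro span_base) (auto simp: D_def)
    moreover have "(a, 1) \<in> span (insert (a, 1) (i ` D))"
      by (intro span_base) simp
    ultimately have "(a, 1) + i (- a + p) \<in> span (insert (a, 1) (i ` D))"
      using span_add by blast
    then show ?thesis by (simp add: i_def)
  qed
  ultimately show thesis
    using that[of "span (insert (a, 1) (i ` D))"] by simp
qed

section \<open>Iterated quantifiers along a filter\<close>

text \<open>The quantifier "for almost all" repeated \<open>m\<close> times. The balls already
  chosen are collected in \<open>\<B>\<close>, and the outermost quantifier chooses first.\<close>

primrec nested :: "'b filter \<Rightarrow> ('b set \<Rightarrow> bool) \<Rightarrow> nat \<Rightarrow> 'b set \<Rightarrow> bool" where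
  "nested V T 0 \<B> = T \<B>"
| "nested V T (Suc m) \<B> = eventually (\<lambda>B. nested V T m (insert B \<B>)) V"

lemma nested_mono:
  assumes "\<And>\<B>. T \<B> \<Longrightarrow> T' \<B>" "nested V T m \<B>"
  shows "nested V T' m \<B>"
  using assms(2) by (induction m arbitrary: \<B>) (auto intro: assms(1) eventually_mono)

text \<open>This appends an innermost quantifier, that is, a last ball. \<open>Q\<close> is carried
  along so that \<open>step\<close> may assume it of the earlier balls; it will be
  compactness.\<close>

lemma nested_shift:
  assumes Q: "eventually Q V"
    and step: "\<And>\<B>. \<forall>B\<in>\<B>. Q B \<Longrightarrow> T \<B> \<Longrightarrow> eventually (\<lambda>B. T' (insert B \<B>)) V"
    and "\<forall>B\<in>\<B>. Q B" "nested V T m \<B>"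
  shows "nested V T' (Suc m) \<B>"
  using assms(3,4)
proof (induction m arbitrary: \<B>)
  case 0
  then show ?case using step by simp
next
  case (Suc m)
  then have "eventually (\<lambda>B. nested V T m (insert B \<B>)) V" by simp
  with Q have "eventually (\<lambda>B. nested V T' (Suc m) (insert B \<B>)) V"
  proof eventually_elim
    case (elim B)
    then show ?case using Suc.IH[of "insert B \<B>"] Suc.prems(1) by simp
  qed
  then show ?case by (subst nested.simps)
qed

text \<open>Homogeneous coordinates: a point \<open>p\<close> becomes \<open>(p, 1)\<close>, so a \<open>k\<close>-flat becomes a linear subspace of
  dimension \<open>k + 1\<close>, and limits of flats that go to infinity stay in the picture.\<close>

definition avoids :: "nat \<Rightarrow> ('a::euclidean_space \<times> real) set \<Rightarrow> 'a set set \<Rightarrow> bool" where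
  "avoids n M \<B> \<longleftrightarrow>
     \<not> (\<exists>W. subspace W \<and> dim W \<le> n \<and> M \<subseteq> W \<and> (\<forall>B\<in>\<B>. \<exists>p\<in>B. (p, 1) \<in> W))"

section \<open>Adding a limit direction to the fixed subspace\<close>

text \<open>In the application \<open>n\<close> is \<open>k + 1\<close>, the dimension of a lifted
  \<open>k\<close>-flat, and \<open>avoid\<close> records that no fixed flat meets almost all
  balls.\<close>

locale avoiding_ultrafilter =
  fixes V :: "'a::euclidean_space set filter" and n :: nat
  assumes ultra: "ultrafilter V"
    and balls: "eventually closed_ball V"
    and avoid: "\<And>U :: ('a \<times> real) set. subspace U \<Longrightarrow> dim U \<le> n \<Longrightarrow> eventually (\<lambda>B. \<forall>p\<in>B. (p, 1) \<notin> U) V"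
begin

lemma not_hit:
  fixes U :: "('a \<times> real) set"
  assumes "subspace U" "dim U \<le> n" "eventually (\<lambda>B. f B \<in> B \<and> (f B, 1) \<in> U) V"
  shows False
proof -
  have "eventually (\<lambda>B. False) V"
    using avoid[OF assms(1,2)] assms(3) by eventually_elim auto
  then show False using ultrafilter_nontrivial[OF ultra] by simp
qed

end

text \<open>One inductive step: \<open>M\<close> is the subspace fixed so far, \<open>\<pi>\<close>
  projects along it, and \<open>w\<close> is the limiting direction of the centres modulo
  \<open>M\<close>.\<close>

locale flag_extension = avoiding_ultrafilter +
  fixes M :: "('a::euclidean_space \<times> real) set" and \<pi> :: "'a \<times> real \<Rightarrow> 'a \<times> real"
    and c :: "'a set \<Rightarrow> 'a" and r :: "'a set \<Rightarrow> real"
    and w :: "'a \<times> real"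
  assumes M: "subspace M" "dim M < n"
    and \<pi>: "linear \<pi>" "\<And>v. v - \<pi> v \<in> M" "\<And>v. norm (\<pi> v) \<le> norm v" "\<And>v. v \<in> M \<Longrightarrow> \<pi> v = 0"
    and ball: "eventually (\<lambda>B. B = cball (c B) (r B) \<and> 0 \<le> r B) V"
    and w: "((\<lambda>B. \<pi> (c B, 1) /\<^sub>R norm (\<pi> (c B, 1))) \<longlongrightarrow> w) V"
begin

text \<open>The distance of the lifted centre from \<open>M\<close>.\<close>

definition h :: "'a set \<Rightarrow> real" where "h B = norm (\<pi> (c B, 1))"

lemma w_h: "((\<lambda>B. \<pi> (c B, 1) /\<^sub>R h B) \<longlongrightarrow> w) V"
  using w by (simp add: h_def)

lemma proj_diff: "\<pi> (u - v) = \<pi> u - \<pi> v"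
  using \<pi>(1) by (simp add: linear_diff)

lemma h_pos: "eventually (\<lambda>B. h B > 0) V"
  using ball avoid[OF M(1) less_imp_le[OF M(2)]]
proof eventually_elim
  case (elim B)
  then have "(c B, 1) \<notin> M" by auto
  then have "\<pi> (c B, 1) \<noteq> 0" using \<pi>(2)[of "(c B, 1)"] by auto
  then show ?case by (simp add: h_def)
qed

lemma norm_w: "norm w = 1"
proof -
  have "((\<lambda>B. norm (\<pi> (c B, 1) /\<^sub>R h B)) \<longlongrightarrow> 1) V"
    by (rule tendsto_eventually) (use h_pos in \<open>eventually_elim, simp add: h_def\<close>)
  then show ?thesis
    using tendsto_unique[OF ultrafilter_nontrivial[OF ultra] _ tendsto_norm[OF w_h]] by metis
qed

text \<open>Otherwise the radius is at least \<open>s * h B\<close> for almost all balls. Turning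
  the projected centre into the direction \<open>w\<close> moves it by a small fraction of
  \<open>h B\<close>, so a point of the fixed \<open>U\<close> remains in the ball.\<close>

lemma radius_ratio:
  assumes U: "subspace U" "dim U \<le> n" "M \<subseteq> U" "w \<in> U" "(y, 1) \<in> U"
  shows "((\<lambda>B. r B / h B) \<longlongrightarrow> 0) V"
proof (rule ccontr)
  assume "\<not> ?thesis"
  then obtain s where s: "s > 0" "\<not> eventually (\<lambda>B. dist (r B / h B) 0 < s) V"
    by (auto simp: tendsto_iff)
  \<comment> \<open>The shift of the centre costs at most \<open>\<epsilon> * r B\<close>, the
    correction of the height at most \<open>norm (y, 1)\<close> times as much; this
    \<open>\<epsilon>\<close> makes the sum \<open>r B\<close>.\<close>
  define \<epsilon> where "\<epsilon> = 1 / (1 + norm (y, 1::real))"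
  have "1 + norm (y, 1::real) > 0" by (intro add_pos_nonneg) auto
  then have \<epsilon>: "\<epsilon> > 0" "\<epsilon> * (1 + norm (y, 1::real)) = 1"
    unfolding \<epsilon>_def by (simp_all only: divide_pos_pos zero_less_one) simp
  \<comment> \<open>\<open>z B\<close> lies in \<open>U\<close> but need not have height 1;
    \<open>x B\<close> restores the height with the finite point \<open>y\<close> of
    \<open>U\<close>.\<close>
  define z where "z B = h B *\<^sub>R w + ((c B, 1) - \<pi> (c B, 1))" for B
  define x where "x B = z B - (snd (z B) - 1) *\<^sub>R (y, 1)" for B
  have "eventually (\<lambda>B. dist (\<pi> (c B, 1) /\<^sub>R h B) w < \<epsilon> * s) V"
    using w_h s(1) \<epsilon>(1) by (auto simp: tendsto_iff)
  with ball h_pos ultrafilter_not_eventually[OF ultra s(2)]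
  have "eventually (\<lambda>B. fst (x B) \<in> B \<and> (fst (x B), 1) \<in> U) V"
  proof eventually_elim
    case (elim B)
    then have sh: "s * h B \<le> r B" and r: "0 \<le> r B"
      by (auto simp: dist_norm field_simps)
    have "z B - (c B, 1) = - (h B *\<^sub>R (\<pi> (c B, 1) /\<^sub>R h B - w))"
      using elim by (simp add: z_def algebra_simps)
    then have "norm (z B - (c B, 1)) = h B * dist (\<pi> (c B, 1) /\<^sub>R h B) w"
      using elim by (simp only: norm_minus_cancel norm_scaleR dist_norm)
    also have "\<dots> \<le> h B * (\<epsilon> * s)"
      using elim by (intro mult_left_mono) auto
    also have "\<dots> \<le> \<epsilon> * r B"
      using mult_left_mono[OF sh, of \<epsilon>] \<epsilon>(1) by (simp add: mult_ac)
    finally have z: "norm (z B - (c B, 1)) \<le> \<epsilon> * r B" .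
    have "\<bar>snd (z B) - 1\<bar> \<le> \<epsilon> * r B"
      using dist_snd_le[of "z B" "(c B, 1)"] z by (simp add: dist_norm)
    then have "norm ((snd (z B) - 1) *\<^sub>R (y, 1::real)) \<le> \<epsilon> * r B * norm (y, 1::real)"
      unfolding norm_scaleR by (intro mult_right_mono) auto
    then have "norm (x B - (c B, 1)) \<le> \<epsilon> * r B + \<epsilon> * r B * norm (y, 1::real)"
      using z norm_triangle_ineq4[of "z B - (c B, 1)" "(snd (z B) - 1) *\<^sub>R (y, 1)"]
      by (simp add: x_def algebra_simps)
    also have "\<dots> = r B"
      using \<epsilon>(2) by (metis (no_types, opaque_lifting) distrib_left mult.assoc mult.commute mult.right_neutral)
    finally have "norm (x B - (c B, 1)) \<le> r B" .
    then have "norm (fst (x B) - c B) \<le> r B"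
      using dist_fst_le[of "x B" "(c B, 1)"] by (simp add: dist_norm)
    then have 1: "fst (x B) \<in> cball (c B) (r B)"
      by (simp add: dist_norm norm_minus_commute)
    have "z B \<in> U"
      unfolding z_def using U \<pi>(2) by (intro subspace_add subspace_scale) auto
    then have "x B \<in> U"
      unfolding x_def using U by (intro subspace_diff subspace_scale) auto
    moreover have "x B = (fst (x B), 1)"
      by (rule prod_eqI) (simp_all add: x_def)
    ultimately have "(fst (x B), 1) \<in> U" by metis
    with 1 elim show ?case by simp
  qed
  then show False by (rule not_hit[OF U(1,2)])
qed

text \<open>The balls look small from \<open>M\<close>, so a limit of subspaces that contain \<open>M\<close> and meet the balls contains \<open>w\<close>.\<close>

lemma avoids_insert_of_ratio:
  assumes ratio: "((\<lambda>B. r B / h B) \<longlongrightarrow> 0) V"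
    and cpt: "\<forall>B\<in>\<B>. compact B"
    and av: "avoids n (span (insert w M)) \<B>"
  shows "eventually (\<lambda>B. avoids n M (insert B \<B>)) V"
proof (rule ccontr)
  assume "\<not> ?thesis"
  from ultrafilter_not_eventually[OF ultra this]
  obtain W' where W': "eventually (\<lambda>B. subspace (W' B) \<and> dim (W' B) \<le> n \<and> M \<subseteq> W' B
      \<and> (\<forall>C\<in>insert B \<B>. \<exists>p\<in>C. (p, 1) \<in> W' B)) V"
    unfolding avoids_def not_not eventually_ex by blast
  \<comment> \<open>The limit lemma wants the dimension bound everywhere, hence the default
    \<open>{0}\<close> on the negligible set where \<open>W'\<close> fails.\<close>
  define W where "W B = (if subspace (W' B) \<and> dim (W' B) \<le> n then W' B else {0})" for B
  have W: "subspace (W B)" "dim (W B) \<le> n" for B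
    by (auto simp: W_def)
  have WM: "eventually (\<lambda>B. M \<subseteq> W B) V"
    using W' by eventually_elim (auto simp: W_def)
  have hit: "eventually (\<lambda>B. \<exists>p. p \<in> C \<and> (p, 1) \<in> W B) V" if "C \<in> \<B>" for C
    using W' by eventually_elim (use that in \<open>auto simp: W_def\<close>)
  have "eventually (\<lambda>B. \<exists>p. p \<in> B \<and> (p, 1) \<in> W B) V"
    using W' by eventually_elim (auto simp: W_def)
  then obtain p where p: "eventually (\<lambda>B. p B \<in> B \<and> (p B, 1) \<in> W B) V"
    unfolding eventually_ex by blast
  obtain U where U: "subspace U" "dim U \<le> n"
    "\<And>f v. eventually (\<lambda>x. f x \<in> W x) V \<Longrightarrow> (f \<longlongrightarrow> v) V \<Longrightarrow> v \<in> U"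
    using ultrafilter_limit_subspace[of V W n] ultra W by blast
  have "M \<subseteq> U"
  proof
    fix v assume "v \<in> M"
    then show "v \<in> U"
      by (intro U(3)[of "\<lambda>_. v"]) (use WM in \<open>auto elim!: eventually_mono\<close>)
  qed
  moreover have "w \<in> U"
  proof (rule U(3))
    show "eventually (\<lambda>B. \<pi> (p B, 1) /\<^sub>R h B \<in> W B) V"
      using p WM
    proof eventually_elim
      case (elim B)
      have "(p B, 1) - \<pi> (p B, 1) \<in> W B" using elim \<pi>(2) by blast
      then have "(p B, 1) - ((p B, 1) - \<pi> (p B, 1)) \<in> W B"
        using elim W(1) subspace_diff by blast
      then have "\<pi> (p B, 1) \<in> W B" by simp
      then show ?case using W(1) by (intro subspace_scale)
    qed
    have "((\<lambda>B. \<pi> (p B, 1) /\<^sub>R h B - \<pi> (c B, 1) /\<^sub>R h B) \<longlongrightarrow> 0) V"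
    proof (rule Lim_null_comparison[OF _ ratio])
      show "eventually (\<lambda>B. norm (\<pi> (p B, 1) /\<^sub>R h B - \<pi> (c B, 1) /\<^sub>R h B) \<le> r B / h B) V"
        using p ball h_pos
      proof eventually_elim
        case (elim B)
        have "norm (\<pi> (p B, 1) - \<pi> (c B, 1)) \<le> norm ((p B, 1) - (c B, 1::real))"
          using \<pi>(3)[of "(p B, 1) - (c B, 1)"] by (simp only: proj_diff)
        also have "\<dots> = dist (c B) (p B)"
          by (simp add: dist_norm norm_minus_commute norm_Pair)
        also have "\<dots> \<le> r B"
          using elim by (metis mem_cball)
        finally have "norm ((\<pi> (p B, 1) - \<pi> (c B, 1)) /\<^sub>R h B) \<le> r B / h B"
          using elim by (simp add: divide_inverse mult.commute mult_left_mono)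
        then show ?case by (simp add: scaleR_diff_right)
      qed
    qed
    from tendsto_add[OF this w_h] show "((\<lambda>B. \<pi> (p B, 1) /\<^sub>R h B) \<longlongrightarrow> w) V" by simp
  qed
  ultimately have "span (insert w M) \<subseteq> U"
    using U(1) by (intro span_minimal) auto
  moreover have "\<exists>q\<in>C. (q, 1) \<in> U" if C: "C \<in> \<B>" for C
  proof -
    obtain q where q: "eventually (\<lambda>B. q B \<in> C \<and> (q B, 1) \<in> W B) V"
      using hit[OF C] unfolding eventually_ex by blast
    then have "eventually (\<lambda>B. q B \<in> C) V" by eventually_elim simp
    with C cpt obtain l where l: "l \<in> C" "(q \<longlongrightarrow> l) V"
      using ultrafilter_compact_tendsto[OF ultra] by blast
    have "(l, 1) \<in> U"
    proof (rule U(3))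
      show "eventually (\<lambda>B. (q B, 1) \<in> W B) V" using q by eventually_elim simp
      show "((\<lambda>B. (q B, 1)) \<longlongrightarrow> (l, 1)) V" using l by (intro tendsto_intros)
    qed
    with l show ?thesis by blast
  qed
  ultimately show False
    using av U(1,2) unfolding avoids_def by blast
qed

text \<open>The exceptional case in which no subspace through \<open>M\<close> and \<open>w\<close> of admissible dimension has a finite
  point: balls that run to infinity modulo \<open>M\<close> while meeting the translates of \<open>M\<close> through the
  compact set \<open>C\<close> get large in the direction \<open>w\<close>, and so swallow the point \<open>w\<close> beyond a limit point
  \<open>q0\<close> of those translates, up to \<open>M\<close>.\<close>

lemma avoids_insert_horizontal:
  assumes dimM: "n = dim M + 1"
    and hor: "\<And>v. v \<in> M \<Longrightarrow> snd v = 0" "snd w = 0"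
    and C: "C \<in> \<B>" "compact C"
  shows "eventually (\<lambda>B. avoids n M (insert B \<B>)) V"
proof (rule ccontr)
  assume "\<not> ?thesis"
  from ultrafilter_not_eventually[OF ultra this]
  have "eventually (\<lambda>B. \<exists>x. fst x \<in> B \<and> snd x \<in> C \<and> (fst x, 1) - (snd x, 1) \<in> M) V"
  proof eventually_elim
    case (elim B)
    then obtain W p q where W: "subspace W" "dim W \<le> n" "M \<subseteq> W"
      and p: "p \<in> B" "(p, 1) \<in> W" and q: "q \<in> C" "(q, 1) \<in> W"
      using C(1) by (auto simp: avoids_def)
    \<comment> \<open>By dimension, \<open>W\<close> is spanned by \<open>M\<close> and
      \<open>(q, 1)\<close>; since \<open>M\<close> has height 0, comparing heights puts
      \<open>(p, 1) - (q, 1)\<close> into \<open>M\<close>.\<close>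
    have "(q, 1) \<notin> M" using hor(1)[of "(q, 1)"] by auto
    then have "dim (insert (q, 1) M) = n"
      using M(1) dimM by (simp add: dim_insert span_eq_iff[THEN iffD2])
    then have "span (insert (q, 1) M) = W"
      using W q span_minimal[of "insert (q, 1) M" W] by (intro subspace_dim_equal) auto
    then obtain t where t: "(p, 1) - t *\<^sub>R (q, 1) \<in> M"
      using p M(1) by (auto simp: span_breakdown_eq span_eq_iff[THEN iffD2])
    then have "t = 1" using hor(1)[OF t] by simp
    then show ?case using t p q by (intro exI[of _ "(p, q)"]) simp
  qed
  then obtain x where x: "eventually (\<lambda>B. fst (x B) \<in> B \<and> snd (x B) \<in> C
      \<and> (fst (x B), 1) - (snd (x B), 1) \<in> M) V"
    unfolding eventually_ex by blast
  define p where "p = fst \<circ> x"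
  define q where "q = snd \<circ> x"
  have pq: "eventually (\<lambda>B. p B \<in> B \<and> q B \<in> C \<and> (p B, 1) - (q B, 1) \<in> M) V"
    using x by (simp add: p_def q_def)
  then have "eventually (\<lambda>B. q B \<in> C) V" by eventually_elim simp
  then obtain q0 where q0: "q0 \<in> C" "(q \<longlongrightarrow> q0) V"
    using ultrafilter_compact_tendsto[OF ultra C(2)] by blast
  have snd\<pi>: "snd (\<pi> v) = snd v" for v
    using hor(1)[OF \<pi>(2)[of v]] by simp
  have "((\<lambda>B. snd (\<pi> (c B, 1) /\<^sub>R h B)) \<longlongrightarrow> snd w) V"
    by (intro tendsto_intros w_h)
  \<comment> \<open>The projection keeps the height 1 of the lifted centre, while \<open>w\<close>
    has height 0; hence \<open>h\<close> tends to infinity.\<close>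
  then have hinv: "((\<lambda>B. inverse (h B)) \<longlongrightarrow> 0) V"
    by (simp add: snd\<pi> hor(2))
  \<comment> \<open>As \<open>q B\<close> converges and \<open>h B\<close> tends to infinity,
    \<open>a B\<close> has the limiting direction \<open>w\<close> too. Modulo \<open>M\<close> it
    is also the vector from \<open>p B\<close> to the centre, so its length is at most
    \<open>r B\<close>.\<close>
  define a where "a B = \<pi> (c B, 1) - \<pi> (q B, 1)" for B
  have lq: "((\<lambda>B. \<pi> (q B, 1)) \<longlongrightarrow> \<pi> (q0, 1)) V"
    using \<pi>(1) q0(2) by (intro bounded_linear.tendsto[of \<pi>] tendsto_intros)
      (simp_all add: linear_conv_bounded_linear)
  have ah: "((\<lambda>B. a B /\<^sub>R h B) \<longlongrightarrow> w) V"
    using tendsto_diff[OF w_h tendsto_scaleR[OF hinv lq]]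
    by (simp add: a_def scaleR_diff_right)
  have nah: "((\<lambda>B. norm (a B /\<^sub>R h B)) \<longlongrightarrow> 1) V"
    using tendsto_norm[OF ah] norm_w by simp
  have "((\<lambda>B. (a B /\<^sub>R h B) /\<^sub>R norm (a B /\<^sub>R h B)) \<longlongrightarrow> w /\<^sub>R 1) V"
    by (intro tendsto_intros ah nah) simp
  moreover have "eventually (\<lambda>B. (a B /\<^sub>R h B) /\<^sub>R norm (a B /\<^sub>R h B) = a B /\<^sub>R norm (a B)) V"
    using h_pos by eventually_elim simp
  ultimately have ea: "((\<lambda>B. a B /\<^sub>R norm (a B)) \<longlongrightarrow> w) V"
    using Lim_transform_eventually by fastforce
  have a1: "eventually (\<lambda>B. norm (a B) \<ge> 1) V"
  proof -
    have "eventually (\<lambda>B. inverse (h B) < 1/2) V"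
      using order_tendstoD(2)[OF hinv, of "1/2"] by simp
    moreover have "eventually (\<lambda>B. norm (a B /\<^sub>R h B) > 1/2) V"
      using order_tendstoD(1)[OF nah, of "1/2"] by simp
    ultimately show ?thesis using h_pos
      by eventually_elim (auto simp: field_simps)
  qed
  \<comment> \<open>Modulo \<open>M\<close> the lift of this point is \<open>(q0, 1) + w\<close>, so
    it lies in the fixed \<open>U\<close>.\<close>
  define y where "y B = c B - fst (a B) + fst w + q0 - q B" for B
  define U where "U = span (insert ((q0, 1) + w) M)"
  have "eventually (\<lambda>B. dist (a B /\<^sub>R norm (a B)) w < 1/2) V"
    using tendstoD[OF ea, of "1/2"] by simp
  moreover have "eventually (\<lambda>B. dist (q B) q0 < 1/2) V"
    using tendstoD[OF q0(2), of "1/2"] by simp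
  ultimately have "eventually (\<lambda>B. y B \<in> B \<and> (y B, 1) \<in> U) V"
    using pq ball a1
  proof eventually_elim
    case (elim B)
    define g where "g = norm (a B)"
    have g: "g \<ge> 1" using elim by (simp add: g_def)
    have "\<pi> ((p B, 1) - (q B, 1)) = 0" using elim \<pi>(4) by blast
    then have "a B = \<pi> ((c B, 1) - (p B, 1))"
      by (simp only: a_def proj_diff) simp
    then have "g \<le> norm ((c B, 1) - (p B, 1::real))"
      using \<pi>(3) by (simp only: g_def)
    also have "\<dots> = dist (c B) (p B)" by (simp add: dist_norm norm_Pair)
    also have "\<dots> \<le> r B" using elim by (metis mem_cball)
    finally have gr: "g \<le> r B" .
    \<comment> \<open>Stepping along \<open>w\<close> shortens \<open>a B\<close> by one unit; the
      deviations of its direction and of \<open>q B\<close> from their limits cost less than 1/2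
      each, so the distance is at most \<open>g\<close>.\<close>
    have "y B - c B = fst ((1 / g - 1) *\<^sub>R a B) - fst (a B /\<^sub>R g - w) - (q B - q0)"
      by (simp add: y_def algebra_simps divide_inverse)
    then have "norm (y B - c B) \<le> norm (fst ((1 / g - 1) *\<^sub>R a B)) + norm (fst (a B /\<^sub>R g - w))
        + norm (q B - q0)"
      by (smt (verit) norm_triangle_ineq4)
    also have "\<dots> \<le> norm ((1 / g - 1) *\<^sub>R a B) + norm (a B /\<^sub>R g - w) + norm (q B - q0)"
      using dist_fst_le[of "(1 / g - 1) *\<^sub>R a B" 0] dist_fst_le[of "a B /\<^sub>R g - w" 0]
      by (intro add_mono order_refl) simp_all
    also have "norm ((1 / g - 1) *\<^sub>R a B) = g - 1"
      using g by (simp add: g_def[symmetric] field_simps abs_if)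
    also have "g - 1 + norm (a B /\<^sub>R g - w) + norm (q B - q0) \<le> g"
      using elim by (simp add: g_def dist_norm)
    finally have "y B \<in> B"
      using gr elim by (metis dist_commute dist_norm mem_cball order_trans)
    moreover have "(y B, 1) \<in> U"
    proof -
      have "(y B, 1) = ((c B, 1) - \<pi> (c B, 1)) - ((q B, 1) - \<pi> (q B, 1)) + ((q0, 1) + w)"
        by (rule prod_eqI) (simp_all add: y_def a_def snd\<pi> hor(2))
      also have "\<dots> \<in> U"
      proof (rule subspace_add)
        have "v - \<pi> v \<in> U" for v
          using \<pi>(2) by (simp add: U_def span_base)
        then show "((c B, 1) - \<pi> (c B, 1)) - ((q B, 1) - \<pi> (q B, 1)) \<in> U"
          using subspace_diff[of U] by (simp only: U_def subspace_span)
      qed (auto simp: U_def intro: span_base)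
      finally show ?thesis .
    qed
    ultimately show ?case by simp
  qed
  moreover have "dim U \<le> n"
    using dimM by (simp add: U_def dim_insert)
  ultimately show False
    by (intro not_hit[of U y]) (auto simp: U_def)
qed

end

section \<open>Induction on the codimension of the fixed subspace\<close>

context avoiding_ultrafilter
begin

text \<open>Induction on the number \<open>m\<close> of directions still missing. The hypothesis for
  \<open>M\<close> enlarged by \<open>w\<close> handles one ball fewer, and the limit that produced
  \<open>w\<close> adds the innermost ball.\<close>

lemma nested_avoids:
  assumes "subspace M" "dim M + m = n"
  shows "nested V (avoids n M) (Suc m) {}"
  using assms
proof (induction m arbitrary: M)
  case 0
  have "eventually (\<lambda>B. avoids n M {B}) V"
  proof (rule eventually_mono[OF avoid[of M]])
    fix B assume "\<forall>p\<in>B. (p, 1) \<notin> M"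
    then show "avoids n M {B}"
      using subspace_dim_equal[of M] 0 by (auto simp: avoids_def)
  qed (use 0 in auto)
  then show ?case by simp
next
  case (Suc m)
  obtain \<pi> where proj: "linear \<pi>" "\<And>v. v - \<pi> v \<in> M" "\<And>v. norm (\<pi> v) \<le> norm v"
    "\<And>v u. u \<in> M \<Longrightarrow> \<pi> v \<bullet> u = 0" "\<And>v. v \<in> M \<Longrightarrow> \<pi> v = 0"
    using orthogonal_complement_projection[OF Suc.prems(1)] by blast
  obtain c r where cr: "\<And>B::'a set. closed_ball B \<Longrightarrow> 0 \<le> r B \<and> B = cball (c B) (r B)"
  proof -
    have "\<forall>B::'a set. \<exists>c r. closed_ball B \<longrightarrow> 0 \<le> r \<and> B = cball c r"
      unfolding closed_ball_def by blast
    then show thesis using that by metis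
  qed
  have unit: "norm (x /\<^sub>R norm x) \<le> 1" for x :: "'a \<times> real"
    by (cases "x = 0") auto
  obtain w where w: "((\<lambda>B. \<pi> (c B, 1) /\<^sub>R norm (\<pi> (c B, 1))) \<longlongrightarrow> w) V"
    by (rule ultrafilter_bounded_tendsto[OF ultra,
          of "\<lambda>B. \<pi> (c B, 1) /\<^sub>R norm (\<pi> (c B, 1))" 1]) (simp only: unit always_eventually simp_thms)
  have dimM: "dim M < n" using Suc.prems(2) by simp
  interpret flag_extension V n M \<pi> c r w
  proof
    show "eventually (\<lambda>B. B = cball (c B) (r B) \<and> 0 \<le> r B) V"
      using balls by eventually_elim (use cr in blast)
  qed (rule Suc.prems(1) dimM linear_add[OF proj(1)] linear_scale[OF proj(1)] proj(2,3,5) w, assumption?)+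
  have "w \<bullet> u = 0" if "u \<in> M" for u
  proof -
    have "((\<lambda>B. (\<pi> (c B, 1) /\<^sub>R h B) \<bullet> u) \<longlongrightarrow> w \<bullet> u) V"
      by (intro tendsto_intros w_h)
    then show ?thesis
      using proj(4)[OF that] tendsto_unique[OF ultrafilter_nontrivial[OF ultra] tendsto_const, of 0]
      by simp
  qed
  then have "w \<notin> M" using norm_w by (metis inner_eq_zero_iff norm_zero zero_neq_one)
  then have dimw: "dim (span (insert w M)) = dim M + 1"
    using Suc.prems(1) by (simp add: dim_insert span_eq_iff[THEN iffD2])
  have Q: "eventually compact V"
    using balls by eventually_elim (metis cr compact_cball)
  show ?case
  \<comment> \<open>\<open>radius_ratio\<close> needs a subspace through \<open>M\<close> and
    \<open>w\<close> of dimension at most \<open>n\<close> with a finite point. There is none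
    exactly when \<open>M\<close> and \<open>w\<close> have height 0 and no dimension is
    left.\<close>
  proof (cases "(\<forall>v\<in>M. snd v = 0) \<and> snd w = 0 \<and> m = 0")
    case True
    then have "eventually (\<lambda>B. avoids n M {B, C}) V" if "compact C" for C
      using avoids_insert_horizontal[of C "{C}"] that Suc.prems(2) by auto
    then have "eventually (\<lambda>C. eventually (\<lambda>B. avoids n M {B, C}) V) V"
      using Q by (auto elim: eventually_mono)
    then show ?thesis using True by simp
  next
    case False
    \<comment> \<open>A vector of nonzero height is rescaled to height 1; if there is none,
      \<open>m \<noteq> 0\<close> leaves room for the lifted origin \<open>(0, 1)\<close>.\<close>
    obtain U y where U: "subspace U" "dim U \<le> n" "M \<subseteq> U" "w \<in> U" "(y, 1) \<in> U"
    proof (cases "\<exists>v\<in>span (insert w M). snd v \<noteq> 0")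
      case True
      then obtain v where v: "v \<in> span (insert w M)" "snd v \<noteq> 0" by blast
      have "(fst v /\<^sub>R snd v, 1) = v /\<^sub>R snd v"
        using v by (intro prod_eqI) auto
      then have "(fst v /\<^sub>R snd v, 1) \<in> span (insert w M)"
        using v by (metis span_scale)
      then show thesis
        using dimw Suc.prems(2) that[of "span (insert w M)"] by (auto intro: span_base)
    next
      case hor: False
      then have "m \<noteq> 0" using False by (metis insert_iff span_base)
      moreover have "dim (span (insert (0, 1) (insert w M))) \<le> dim M + 2"
        using dimw by (simp add: dim_insert del: dim_insert) (simp add: dim_insert)
      ultimately show thesis
        using Suc.prems(2) that[of "span (insert (0, 1) (insert w M))" 0]
        by (auto intro: span_base)
    qed
    have "nested V (avoids n (span (insert w M))) (Suc m) {}"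
      using Suc.IH[of "span (insert w M)"] dimw Suc.prems(2) by simp
    then show ?thesis
      using nested_shift[OF Q avoids_insert_of_ratio[OF radius_ratio[OF U]]] by blast
  qed
qed

end

section \<open>Transversals, piercing and the filter of the families\<close>

lemma not_has_transversal_of_avoids:
  fixes \<B> :: "'a::euclidean_space set set"
  assumes "avoids (k + 1) {0} \<B>"
  shows "\<not> has_transversal k \<B>"
proof
  assume "has_transversal k \<B>"
  then obtain L where L: "flat k L" "\<forall>B\<in>\<B>. L \<inter> B \<noteq> {}"
    by (auto simp: has_transversal_def)
  obtain U :: "('a \<times> real) set" where U: "subspace U" "dim U \<le> k + 1" "\<And>p. p \<in> L \<Longrightarrow> (p, 1) \<in> U"
    using subspace_of_flat[OF L(1)] by metis
  have "\<forall>B\<in>\<B>. \<exists>p\<in>B. (p, 1) \<in> U"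
    using L(2) U(3) by (meson disjoint_iff)
  then have "\<not> avoids (k + 1) {0} \<B>"
    unfolding avoids_def not_not using U(1,2)
    by (intro exI[of _ U] conjI) (simp_all add: subspace_0)
  then show False using assms by simp
qed

lemma finitely_pierceable_empty: "finitely_pierceable k {}"
  by (auto simp: finitely_pierceable_def)

lemma finitely_pierceable_subset:
  "finitely_pierceable k \<G> \<Longrightarrow> \<F> \<subseteq> \<G> \<Longrightarrow> finitely_pierceable k \<F>"
  unfolding finitely_pierceable_def by (meson subsetD)

lemma finitely_pierceable_Un:
  assumes "finitely_pierceable k \<F>" "finitely_pierceable k \<G>"
  shows "finitely_pierceable k (\<F> \<union> \<G>)"
proof -
  obtain P where P: "finite P" "\<forall>V\<in>P. flat k V" "\<forall>B\<in>\<F>. \<exists>V\<in>P. V \<inter> B \<noteq> {}"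
    using assms(1) by (auto simp: finitely_pierceable_def)
  obtain Q where Q: "finite Q" "\<forall>V\<in>Q. flat k V" "\<forall>B\<in>\<G>. \<exists>V\<in>Q. V \<inter> B \<noteq> {}"
    using assms(2) by (auto simp: finitely_pierceable_def)
  have "\<forall>B\<in>\<F> \<union> \<G>. \<exists>V\<in>P \<union> Q. V \<inter> B \<noteq> {}"
    using P(3) Q(3) by (meson Un_iff)
  then show ?thesis
    unfolding finitely_pierceable_def using P(1,2) Q(1,2)
    by (intro exI[of _ "P \<union> Q"]) (simp add: ball_Un)
qed

text \<open>Ignoring finitely many families makes every property that is large for a finer
  ultrafilter occur at arbitrarily late indices, as increasing indices require.\<close>

definition unpierced_filter :: "nat \<Rightarrow> (nat \<Rightarrow> 'a::euclidean_space set set) \<Rightarrow> 'a set filter" where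
  "unpierced_filter k \<F> =
     Abs_filter (\<lambda>Q. \<exists>N. \<forall>i\<ge>N. finitely_pierceable k {B \<in> \<F> i. \<not> Q B})"

lemma eventually_unpierced_filter:
  "eventually Q (unpierced_filter k \<F>) \<longleftrightarrow>
     (\<exists>N. \<forall>i\<ge>N. finitely_pierceable k {B \<in> \<F> i. \<not> Q B})"
  unfolding unpierced_filter_def
proof (rule eventually_Abs_filter, rule is_filter.intro)
  show "\<exists>N. \<forall>i\<ge>N. finitely_pierceable k {B \<in> \<F> i. \<not> True}"
    by (simp add: finitely_pierceable_empty)
next
  fix P Q
  assume "\<exists>N. \<forall>i\<ge>N. finitely_pierceable k {B \<in> \<F> i. \<not> P B}"
    and "\<exists>N. \<forall>i\<ge>N. finitely_pierceable k {B \<in> \<F> i. \<not> Q B}"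
  then obtain M N where "\<forall>i\<ge>M. finitely_pierceable k {B \<in> \<F> i. \<not> P B}"
    "\<forall>i\<ge>N. finitely_pierceable k {B \<in> \<F> i. \<not> Q B}" by blast
  then have "finitely_pierceable k ({B \<in> \<F> i. \<not> P B} \<union> {B \<in> \<F> i. \<not> Q B})" if "i \<ge> max M N" for i
    using that by (intro finitely_pierceable_Un) auto
  moreover have "{B \<in> \<F> i. \<not> (P B \<and> Q B)} = {B \<in> \<F> i. \<not> P B} \<union> {B \<in> \<F> i. \<not> Q B}" for i
    by blast
  ultimately have "\<forall>i\<ge>max M N. finitely_pierceable k {B \<in> \<F> i. \<not> (P B \<and> Q B)}"
    by simp
  then show "\<exists>N. \<forall>i\<ge>N. finitely_pierceable k {B \<in> \<F> i. \<not> (P B \<and> Q B)}" ..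
next
  fix P Q :: "'a set \<Rightarrow> bool"
  assume PQ: "\<forall>x. P x \<longrightarrow> Q x" and P: "\<exists>N. \<forall>i\<ge>N. finitely_pierceable k {B \<in> \<F> i. \<not> P B}"
  from P obtain N where N: "\<forall>i\<ge>N. finitely_pierceable k {B \<in> \<F> i. \<not> P B}" ..
  have "{B \<in> \<F> i. \<not> Q B} \<subseteq> {B \<in> \<F> i. \<not> P B}" for i
    using PQ by blast
  then have "\<forall>i\<ge>N. finitely_pierceable k {B \<in> \<F> i. \<not> Q B}"
    using N finitely_pierceable_subset[of k "{B \<in> \<F> i. \<not> P B}" "{B \<in> \<F> i. \<not> Q B}" for i] by simp
  then show "\<exists>N. \<forall>i\<ge>N. finitely_pierceable k {B \<in> \<F> i. \<not> Q B}" ..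
qed

section \<open>Choice of the heterochromatic sequence\<close>

text \<open>The terms are chosen one by one. A new term has to extend only finitely many earlier
  index sets, and each of these excludes only a negligible set.\<close>

lemma nested_sequence_exists:
  fixes T :: "'b set \<Rightarrow> bool"
  assumes T: "nested V T m {}"
    and V: "\<And>Q N. eventually Q V \<Longrightarrow> \<exists>i\<ge>N. \<exists>B\<in>\<F> i. Q B"
  shows "\<exists>C. heterochromatic \<F> C \<and> (\<forall>J. finite J \<longrightarrow> card J = m \<longrightarrow> T (C ` J))"
proof -
  \<comment> \<open>The balls with indices in \<open>J\<close> are chosen and the remaining
    \<open>m - card J\<close> quantifiers still hold. A value of \<open>f\<close> is a family index
    paired with a ball.\<close>
  define good where "good J f \<longleftrightarrow> nested V T (m - card J) ((\<lambda>j. snd (f j)) ` J)"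
    for J :: "nat set" and f :: "nat \<Rightarrow> nat \<times> 'b"
  define P where "P f n x \<longleftrightarrow> (\<forall>j<n. fst (f j) < fst x) \<and> snd x \<in> \<F> (fst x) \<and>
      (\<forall>J. J \<subseteq> {..<n} \<longrightarrow> card J < m \<longrightarrow> good J f \<longrightarrow> good (insert n J) (f(n := x)))"
    for f :: "nat \<Rightarrow> nat \<times> 'b" and n x
  have good_insert: "good (insert n J) (f(n := (i, B))) \<longleftrightarrow>
      nested V T (m - Suc (card J)) (insert B ((\<lambda>j. snd (f j)) ` J))"
    if "J \<subseteq> {..<n}" for f :: "nat \<Rightarrow> nat \<times> 'b" and n J i B
  proof -
    have "n \<notin> J" "finite J" using that finite_subset by auto
    moreover have "(\<lambda>j. snd ((f(n := (i, B))) j)) ` J = (\<lambda>j. snd (f j)) ` J"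
      using \<open>n \<notin> J\<close> by (intro image_cong) auto
    ultimately show ?thesis by (simp add: good_def)
  qed
  have "\<exists>f. \<forall>n. P f n (f n)"
  proof (rule dependent_wellorder_choice)
    fix x :: "nat \<times> 'b" and n and f g :: "nat \<Rightarrow> nat \<times> 'b"
    assume fg: "\<And>j. j < n \<Longrightarrow> f j = g j"
    obtain i B where x: "x = (i, B)" by fastforce
    have "(\<lambda>j. snd (f j)) ` J = (\<lambda>j. snd (g j)) ` J" if "J \<subseteq> {..<n}" for J
      using that fg by (intro image_cong) auto
    then have "good J f = good J g" "good (insert n J) (f(n := x)) = good (insert n J) (g(n := x))"
      if "J \<subseteq> {..<n}" for J
      using that by (simp_all only: x good_insert) (simp_all add: good_def)
    then show "P f n x = P g n x"
      by (simp add: P_def fg)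
  next
    fix n and f :: "nat \<Rightarrow> nat \<times> 'b"
    define \<J> where "\<J> = {J \<in> Pow {..<n}. card J < m \<and> good J f}"
    have "eventually (\<lambda>B. \<forall>J\<in>\<J>. nested V T (m - Suc (card J)) (insert B ((\<lambda>j. snd (f j)) ` J))) V"
    proof (rule eventually_ball_finite)
      show "finite \<J>" by (simp add: \<J>_def)
      show "\<forall>J\<in>\<J>. eventually (\<lambda>B. nested V T (m - Suc (card J)) (insert B ((\<lambda>j. snd (f j)) ` J))) V"
      proof
        fix J assume J: "J \<in> \<J>"
        then have "m - card J = Suc (m - Suc (card J))" by (auto simp: \<J>_def)
        with J show "eventually (\<lambda>B. nested V T (m - Suc (card J)) (insert B ((\<lambda>j. snd (f j)) ` J))) V"
          by (auto simp: \<J>_def good_def)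
      qed
    qed
    from V[OF this, of "Suc (\<Sum>j<n. fst (f j))"] obtain i B
      where iB: "Suc (\<Sum>j<n. fst (f j)) \<le> i" "B \<in> \<F> i"
      "\<forall>J\<in>\<J>. nested V T (m - Suc (card J)) (insert B ((\<lambda>j. snd (f j)) ` J))"
      by blast
    have "fst (f j) < i" if "j < n" for j
      using member_le_sum[of j "{..<n}" "\<lambda>j. fst (f j)"] that iB(1) by simp
    then have "P f n (i, B)"
      using iB by (auto simp: P_def good_insert \<J>_def)
    then show "\<exists>x. P f n x" by blast
  qed
  then obtain f where f: "\<And>n. P f n (f n)" by blast
  \<comment> \<open>The elements of \<open>J\<close> enter in increasing order, matching the order
    of the quantifiers.\<close>
  have good: "card J \<le> m \<longrightarrow> good J f" if "finite J" for J
    using that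
  proof (induction rule: finite_linorder_max_induct)
    case empty
    then show ?case using T by (simp add: good_def)
  next
    case (insert n J)
    then have "n \<notin> J" "J \<subseteq> {..<n}" by auto
    then show ?case
      using insert.IH insert.hyps(1) f[of n] by (auto simp: P_def)
  qed
  show ?thesis
  proof (intro exI[of _ "\<lambda>n. snd (f n)"] conjI allI impI)
    show "heterochromatic \<F> (\<lambda>n. snd (f n))"
      unfolding heterochromatic_def
      using f by (intro exI[of _ "\<lambda>n. fst (f n)"]) (auto simp: P_def strict_mono_def)
    show "T ((\<lambda>n. snd (f n)) ` J)" if "finite J" "card J = m" for J
      using good[OF that(1)] that(2) by (simp add: good_def)
  qed
qed

theorem corollary12:
  fixes k :: nat
    and \<F> :: "nat \<Rightarrow> (real ^ 'd) set set"
  assumes "k < CARD('d)"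
    and "\<And>i B. B \<in> \<F> i \<Longrightarrow> closed_ball B"
    and "\<And>C. heterochromatic \<F> C \<Longrightarrow> has_terms_with_transversal (k + 2) k C"
  shows "\<exists>i. finitely_pierceable k (\<F> i)"
proof (rule ccontr)
  assume "\<not> ?thesis"
  then have np: "\<not> finitely_pierceable k (\<F> i)" for i by blast
  have "unpierced_filter k \<F> \<noteq> bot"
    using np by (auto simp: trivial_limit_def eventually_unpierced_filter)
  then obtain V where V: "ultrafilter V" "V \<le> unpierced_filter k \<F>"
    using ultrafilter_exists by blast
  \<comment> \<open>If \<open>Q\<close> failed throughout all late families, its negation would be
    large.\<close>
  have select: "\<exists>i\<ge>N. \<exists>B\<in>\<F> i. Q B" if "eventually Q V" for Q N
  proof (rule ccontr)
    assume none: "\<not> ?thesis"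
    have "{B \<in> \<F> i. \<not> \<not> Q B} = {}" if "i \<ge> N" for i
      using none that by blast
    then have "eventually (\<lambda>B. \<not> Q B) (unpierced_filter k \<F>)"
      unfolding eventually_unpierced_filter
      by (intro exI[of _ N] allI impI) (simp only: finitely_pierceable_empty)
    then have "eventually (\<lambda>B. \<not> Q B) V" using V(2) by (rule filter_leD[rotated])
    with that have "eventually (\<lambda>B. False) V" by eventually_elim simp
    then show False using ultrafilter_nontrivial[OF V(1)] by simp
  qed
  interpret avoiding_ultrafilter V "k + 1"
  proof
    have "{B \<in> \<F> i. \<not> closed_ball B} = {}" for i
      using assms(2) by auto
    then have "eventually closed_ball (unpierced_filter k \<F>)"
      unfolding eventually_unpierced_filter by (simp only: finitely_pierceable_empty simp_thms)
    then show "eventually closed_ball V" using V(2) by (rule filter_leD[rotated])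
  next
    fix U :: "((real ^ 'd) \<times> real) set"
    assume "subspace U" "dim U \<le> k + 1"
    then obtain L where L: "flat k L" "{p. (p, 1) \<in> U} \<subseteq> L"
      using flat_of_subspace[of U k] assms(1) by auto
    \<comment> \<open>One flat through the slice of \<open>U\<close> at height 1 pierces every ball
      that meets this slice, in all families at once.\<close>
    have "finitely_pierceable k {B \<in> \<F> i. \<not> (\<forall>p\<in>B. (p, 1) \<notin> U)}" for i
      unfolding finitely_pierceable_def using L by (intro exI[of _ "{L}"]) auto
    then have "eventually (\<lambda>B. \<forall>p\<in>B. (p, 1) \<notin> U) (unpierced_filter k \<F>)"
      unfolding eventually_unpierced_filter by blast
    then show "eventually (\<lambda>B. \<forall>p\<in>B. (p, 1) \<notin> U) V" using V(2) by (rule filter_leD[rotated])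
  qed (rule V)
  \<comment> \<open>Starting from \<open>{0}\<close>, \<open>k + 1\<close> directions are missing,
    which accounts for \<open>k + 2\<close> balls.\<close>
  have "nested V (avoids (k + 1) {0}) (k + 2) {}"
    using nested_avoids[of "{0}" "k + 1"] by simp
  then have nested: "nested V (\<lambda>\<B>. \<not> has_transversal k \<B>) (k + 2) {}"
  proof (rule nested_mono[rotated])
    fix \<B> :: "(real ^ 'd) set set"
    assume "avoids (k + 1) {0} \<B>"
    then show "\<not> has_transversal k \<B>" by (rule not_has_transversal_of_avoids)
  qed
  have "\<exists>C. heterochromatic \<F> C \<and>
      (\<forall>J. finite J \<longrightarrow> card J = k + 2 \<longrightarrow> \<not> has_transversal k (C ` J))"
  proof (rule nested_sequence_exists)
    show "nested V (\<lambda>\<B>. \<not> has_transversal k \<B>) (k + 2) {}" by (rule nested)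
    show "\<exists>i\<ge>N. \<exists>B\<in>\<F> i. Q B" if "eventually Q V" for Q N by (rule select[OF that])
  qed
  then obtain C where C: "heterochromatic \<F> C"
    "\<forall>J. finite J \<longrightarrow> card J = k + 2 \<longrightarrow> \<not> has_transversal k (C ` J)"
    by (elim exE conjE)
  obtain J where "finite J" "card J = k + 2" "has_transversal k (C ` J)"
    using assms(3)[OF C(1)] by (auto simp: has_terms_with_transversal_def)
  then show False using C(2) by simp
qed

end
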